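(* Let $(X,r)$ be a solution. If $(X,r)$ is $\theta_f$, then the structure skew brace $B(X,r)$ is a $\theta_f$-skew brace. Vice versa, if $B(X,r)$ is a $\theta_f$-skew brace and $(X,r)$ is injective, then $(X,r)$ is $\theta_f$.
   Context: A solution is a pair $(X,r)$ with $X$ a non-empty set and $r:X\times X\to X\times X$, $r(x,y)=(\lambda_x(y),\rho_y(x))$, a bijection satisfying $(r\times\mathrm{id})(\mathrm{id}\times r)(r\times\mathrm{id})=(\mathrm{id}\times r)(r\times\mathrm{id})(\mathrm{id}\times r)$ on $X^3$, with all maps $\lambda_x,\rho_x:X\to X$ bijective. A subset $Y\subseteq X$ is a subsolution if $r$ restricts to a solution on $Y$. If $X=Y\cup Z$ is a disjoint union of two subsolutions (one of them allowed to be empty), then $Y$ and $Z$ are called decomposition factors. An element $x\in X$ is $\theta_f$ if it lies in a finite decomposition factor; $(X,r)$ is $\theta_f$ if all its elements are $\theta_f$. A skew brace is a triple $(B,+,\circ)$ where $(B,+)$ and $(B,\circ)$ are groups with $a\circ(b+c)=a\circ b-a+a\circ c$ for all $a,b,c$. Put $\lambda_a(b)=-a+a\circ b$ and $\theta_{(a,b)}(c)=a+\lambda_b(c)-a$. $B$ is a $\theta_f$-skew brace if for every $x\in B$ the set $\{\theta_{(a,b)}(x):a,b\in B\}$ is finite. The solution associated with a skew brace $B$ is $(B,r_B)$, $r_B(a,b)=(\lambda_a(b),\overline{\lambda_a(b)}\circ a\circ b)$, where $\overline{c}$ is the inverse of $c$ in $(B,\circ)$. The structure group is $G(X,r)=\langle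 x\in X\mid x\circ y=\lambda_x(y)\circ\rho_y(x)\text{ for all }x,y\in X\rangle$, with canonical map $\iota:X\to G(X,r)$. The structure skew brace $B(X,r)$ is the (unique) skew brace with multiplicative group $G(X,r)$ for which $r_{B(X,r)}\circ(\iota\times\iota)=(\iota\times\iota)\circ r$ (composition of maps); its additive group is generated by $\iota(X)$ and is isomorphic to $G(X,r')$ with $r'(x,y)=(y,\lambda_y\rho_{\lambda_x^{-1}(y)}(x))$. $(X,r)$ is injective if $\iota$ is injective. *)

theory Defs
  imports "HOL-Algebra.Group" "HOL-Algebra.Ring"
begin

section \<open>Set-theoretic solutions of the Yang-Baxter equation\<close>

definition lam :: "('a \<times> 'a \<Rightarrow> 'a \<times> 'a) \<Rightarrow> 'a \<Rightarrow> 'a \<Rightarrow> 'a" where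
  "lam r x y = fst (r (x, y))"

text \<open>The subscript comes first: \<open>rho r y x\<close> is $\rho_y(x)$, so
  \<open>r (x, y) = (lam r x y, rho r y x)\<close>.\<close>

definition rho :: "('a \<times> 'a \<Rightarrow> 'a \<times> 'a) \<Rightarrow> 'a \<Rightarrow> 'a \<Rightarrow> 'a" where
  "rho r y x = snd (r (x, y))"

definition on12 :: "('a \<times> 'a \<Rightarrow> 'a \<times> 'a) \<Rightarrow> 'a \<times> 'a \<times> 'a \<Rightarrow> 'a \<times> 'a \<times> 'a" where
  "on12 r = (\<lambda>(x, y, z). (fst (r (x, y)), snd (r (x, y)), z))"

definition on23 :: "('a \<times> 'a \<Rightarrow> 'a \<times> 'a) \<Rightarrow> 'a \<times> 'a \<times> 'a \<Rightarrow> 'a \<times> 'a \<times> 'a" where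
  "on23 r = (\<lambda>(x, y, z). (x, r (y, z)))"

text \<open>The values of \<open>r\<close> outside \<open>X \<times> X\<close> are irrelevant.\<close>

definition solution :: "'a set \<Rightarrow> ('a \<times> 'a \<Rightarrow> 'a \<times> 'a) \<Rightarrow> bool" where
  "solution X r \<longleftrightarrow>
     X \<noteq> {} \<and>
     bij_betw r (X \<times> X) (X \<times> X) \<and>
     (\<forall>t \<in> X \<times> X \<times> X. on12 r (on23 r (on12 r t)) = on23 r (on12 r (on23 r t))) \<and>
     (\<forall>x \<in> X. bij_betw (lam r x) X X \<and> bij_betw (rho r x) X X)"

definition subsolution :: "'a set \<Rightarrow> ('a \<times> 'a \<Rightarrow> 'a \<times> 'a) \<Rightarrow> 'a set \<Rightarrow> bool" where
  "subsolution X r Y \<longleftrightarrow> Y \<subseteq> X \<and> solution Y r"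

text \<open>Solutions are non-empty, so the possibility that one of the two parts of a
  decomposition is empty has to be added explicitly.\<close>

definition decomposition :: "'a set \<Rightarrow> ('a \<times> 'a \<Rightarrow> 'a \<times> 'a) \<Rightarrow> 'a set \<Rightarrow> 'a set \<Rightarrow> bool" where
  "decomposition X r Y Z \<longleftrightarrow>
     X = Y \<union> Z \<and> Y \<inter> Z = {} \<and>
     (Y = {} \<or> subsolution X r Y) \<and> (Z = {} \<or> subsolution X r Z)"

definition decomposition_factor :: "'a set \<Rightarrow> ('a \<times> 'a \<Rightarrow> 'a \<times> 'a) \<Rightarrow> 'a set \<Rightarrow> bool" where
  "decomposition_factor X r Y \<longleftrightarrow> (\<exists>Z. decomposition X r Y Z)"

definition theta_f_element :: "'a set \<Rightarrow> ('a \<times> 'a \<Rightarrow> 'a \<times> 'a) \<Rightarrow> 'a \<Rightarrow> bool" where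
  "theta_f_element X r x \<longleftrightarrow> (\<exists>Y. decomposition_factor X r Y \<and> finite Y \<and> x \<in> Y)"

definition theta_f_solution :: "'a set \<Rightarrow> ('a \<times> 'a \<Rightarrow> 'a \<times> 'a) \<Rightarrow> bool" where
  "theta_f_solution X r \<longleftrightarrow> (\<forall>x \<in> X. theta_f_element X r x)"

section \<open>Skew braces\<close>

text \<open>The two group structures of a skew brace are stored in a ring record:
  \<open>\<oplus>\<close> is the (not necessarily commutative) addition $+$ and \<open>\<otimes>\<close> is $\circ$.\<close>

definition skew_brace :: "('b, 'm) ring_scheme \<Rightarrow> bool" where
  "skew_brace B \<longleftrightarrow>
     group (add_monoid B) \<and> group B \<and>
     (\<forall>a \<in> carrier B. \<forall>b \<in> carrier B. \<forall>c \<in> carrier B.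
        a \<otimes>\<^bsub>B\<^esub> (b \<oplus>\<^bsub>B\<^esub> c) = (a \<otimes>\<^bsub>B\<^esub> b) \<oplus>\<^bsub>B\<^esub> (\<ominus>\<^bsub>B\<^esub> a) \<oplus>\<^bsub>B\<^esub> (a \<otimes>\<^bsub>B\<^esub> c))"

definition sb_lam :: "('b, 'm) ring_scheme \<Rightarrow> 'b \<Rightarrow> 'b \<Rightarrow> 'b" where
  "sb_lam B a b = (\<ominus>\<^bsub>B\<^esub> a) \<oplus>\<^bsub>B\<^esub> (a \<otimes>\<^bsub>B\<^esub> b)"

definition sb_theta :: "('b, 'm) ring_scheme \<Rightarrow> 'b \<times> 'b \<Rightarrow> 'b \<Rightarrow> 'b" where
  "sb_theta B = (\<lambda>(a, b) c. a \<oplus>\<^bsub>B\<^esub> sb_lam B b c \<oplus>\<^bsub>B\<^esub> (\<ominus>\<^bsub>B\<^esub> a))"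

definition theta_f_skew_brace :: "('b, 'm) ring_scheme \<Rightarrow> bool" where
  "theta_f_skew_brace B \<longleftrightarrow>
     skew_brace B \<and>
     (\<forall>x \<in> carrier B. finite {sb_theta B (a, b) x | a b. a \<in> carrier B \<and> b \<in> carrier B})"

definition associated_map :: "('b, 'm) ring_scheme \<Rightarrow> 'b \<times> 'b \<Rightarrow> 'b \<times> 'b" where
  "associated_map B = (\<lambda>(a, b). (sb_lam B a b, inv\<^bsub>B\<^esub> (sb_lam B a b) \<otimes>\<^bsub>B\<^esub> a \<otimes>\<^bsub>B\<^esub> b))"

section \<open>Groups given by generators and relations\<close>

text \<open>Letters \<open>(True, x)\<close> and \<open>(False, x)\<close> stand for the generator $x$ and its formal inverse.\<close>

type_synonym 'a gword = "(bool \<times> 'a) list"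

abbreviation gwords :: "'a set \<Rightarrow> 'a gword set" where
  "gwords S \<equiv> lists (UNIV \<times> S)"

inductive pres_eq :: "'a set \<Rightarrow> ('a gword \<times> 'a gword) set \<Rightarrow> 'a gword \<Rightarrow> 'a gword \<Rightarrow> bool"
  for S R where
  refl: "w \<in> gwords S \<Longrightarrow> pres_eq S R w w"
| sym: "pres_eq S R u v \<Longrightarrow> pres_eq S R v u"
| trans: "pres_eq S R u v \<Longrightarrow> pres_eq S R v w \<Longrightarrow> pres_eq S R u w"
| append: "pres_eq S R u u' \<Longrightarrow> pres_eq S R v v' \<Longrightarrow> pres_eq S R (u @ v) (u' @ v')"
| cancel: "x \<in> S \<Longrightarrow> pres_eq S R [(b, x), (\<not> b, x)] []"
| relator: "(u, v) \<in> R \<Longrightarrow> u \<in> gwords S \<Longrightarrow> v \<in> gwords S \<Longrightarrow> pres_eq S R u v"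

definition pres_class :: "'a set \<Rightarrow> ('a gword \<times> 'a gword) set \<Rightarrow> 'a gword \<Rightarrow> 'a gword set" where
  "pres_class S R u = {v. pres_eq S R u v}"

definition presented_group ::
    "'a set \<Rightarrow> ('a gword \<times> 'a gword) set \<Rightarrow> 'a gword set monoid" where
  "presented_group S R =
     \<lparr>carrier = pres_class S R ` gwords S,
      mult = (\<lambda>A B. \<Union>u \<in> A. \<Union>v \<in> B. pres_class S R (u @ v)),
      one = pres_class S R []\<rparr>"

lemma pres_eq_gwords: "pres_eq S R u v \<Longrightarrow> u \<in> gwords S \<and> v \<in> gwords S"
  by (induction rule: pres_eq.induct) auto

lemma pres_class_eq_iff:
  assumes "u \<in> gwords S"
  shows "pres_class S R u = pres_class S R v \<longleftrightarrow> pres_eq S R u v"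
proof
  assume "pres_class S R u = pres_class S R v"
  then have "u \<in> pres_class S R v" using pres_eq.refl[OF assms, of R] by (auto simp: pres_class_def)
  then show "pres_eq S R u v" unfolding pres_class_def by (auto intro: pres_eq.sym)
next
  assume uv: "pres_eq S R u v"
  show "pres_class S R u = pres_class S R v"
    unfolding pres_class_def
    using pres_eq.trans[OF pres_eq.sym[OF uv]] pres_eq.trans[OF uv] by blast
qed

lemma presented_group_mult:
  assumes "u \<in> gwords S" "v \<in> gwords S"
  shows "pres_class S R u \<otimes>\<^bsub>presented_group S R\<^esub> pres_class S R v = pres_class S R (u @ v)"
proof -
  have eq: "pres_class S R (u' @ v') = pres_class S R (u @ v)"
    if "u' \<in> pres_class S R u" "v' \<in> pres_class S R v" for u' v'
  proof -
    have "pres_eq S R (u @ v) (u' @ v')"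
      using that unfolding pres_class_def by (blast intro: pres_eq.append)
    moreover have "u @ v \<in> gwords S" using assms by simp
    ultimately show ?thesis using pres_class_eq_iff by metis
  qed
  have "u \<in> pres_class S R u" "v \<in> pres_class S R v"
    using assms by (simp_all add: pres_class_def pres_eq.refl)
  then have "(\<Union>u' \<in> pres_class S R u. \<Union>v' \<in> pres_class S R v. pres_class S R (u' @ v')) =
      pres_class S R (u @ v)"
    using eq by blast
  then show ?thesis by (simp add: presented_group_def)
qed

lemma presented_group_inverse:
  assumes "w \<in> gwords S"
  shows "\<exists>w' \<in> gwords S. pres_eq S R (w' @ w) []"
  using assms
proof (induction w rule: lists.induct)
  case Nil
  then show ?case by (auto intro: pres_eq.refl)
next
  case (Cons l w)
  obtain b x where l: "l = (b, x)" by force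
  from Cons obtain w' where w': "w' \<in> gwords S" "pres_eq S R (w' @ w) []" by auto
  have "l \<in> UNIV \<times> S" and w: "w \<in> gwords S"
    using Cons.hyps by simp_all
  then have x: "x \<in> S" using l by simp
  have "pres_eq S R ([(\<not> b, x), (b, x)] @ w) ([] @ w)"
    using pres_eq.append[OF pres_eq.cancel[OF x, of R "\<not> b"] pres_eq.refl[OF w]] by simp
  then have "pres_eq S R (w' @ ([(\<not> b, x), (b, x)] @ w)) (w' @ ([] @ w))"
    by (rule pres_eq.append[OF pres_eq.refl[OF w'(1)]])
  then have "pres_eq S R ((w' @ [(\<not> b, x)]) @ (l # w)) []"
    using pres_eq.trans[OF _ w'(2)] l by simp
  then show ?case using w'(1) x by (intro bexI[of _ "w' @ [(\<not> b, x)]"]) auto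
qed

lemma group_presented_group: "group (presented_group S R)"
proof (rule groupI)
  fix A B C
  let ?G = "presented_group S R"
  have one: "\<one>\<^bsub>?G\<^esub> = pres_class S R []" by (simp add: presented_group_def)
  have car: "carrier ?G = pres_class S R ` gwords S" by (simp add: presented_group_def)
  show "\<one>\<^bsub>?G\<^esub> \<in> carrier ?G" by (auto simp: one car)
  show "A \<otimes>\<^bsub>?G\<^esub> B \<in> carrier ?G" if carr: "A \<in> carrier ?G" "B \<in> carrier ?G"
  proof -
    obtain u v where uv: "u \<in> gwords S" "v \<in> gwords S"
      and AB: "A = pres_class S R u" "B = pres_class S R v"
      using carr unfolding car by blast
    then have "u @ v \<in> gwords S" by (simp only: append_in_lists_conv simp_thms)
    then show ?thesis unfolding car AB presented_group_mult[OF uv] by (rule imageI)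
  qed
  show "A \<otimes>\<^bsub>?G\<^esub> B \<otimes>\<^bsub>?G\<^esub> C = A \<otimes>\<^bsub>?G\<^esub> (B \<otimes>\<^bsub>?G\<^esub> C)"
    if ABC: "A \<in> carrier ?G" "B \<in> carrier ?G" "C \<in> carrier ?G"
  proof -
    obtain u v w where "u \<in> gwords S" "v \<in> gwords S" "w \<in> gwords S"
      and "A = pres_class S R u" "B = pres_class S R v" "C = pres_class S R w"
      using ABC unfolding car by blast
    then show ?thesis
      by (simp only: presented_group_mult append_in_lists_conv append_assoc simp_thms)
  qed
  show "\<one>\<^bsub>?G\<^esub> \<otimes>\<^bsub>?G\<^esub> A = A" if carr: "A \<in> carrier ?G"
  proof -
    obtain u where u: "u \<in> gwords S" "A = pres_class S R u"
      using carr unfolding car by blast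
    then show ?thesis by (simp only: one presented_group_mult lists.Nil append_Nil)
  qed
  show "\<exists>y \<in> carrier ?G. y \<otimes>\<^bsub>?G\<^esub> A = \<one>\<^bsub>?G\<^esub>" if carr: "A \<in> carrier ?G"
  proof -
    obtain w where w: "w \<in> gwords S" "A = pres_class S R w" using carr unfolding car by blast
    obtain w' where w': "w' \<in> gwords S" "pres_eq S R (w' @ w) []"
      using presented_group_inverse[OF w(1)] by blast
    then have "pres_class S R w' \<otimes>\<^bsub>?G\<^esub> A = \<one>\<^bsub>?G\<^esub>"
      using w by (simp only: presented_group_mult one pres_class_eq_iff append_in_lists_conv simp_thms)
    then show ?thesis using w'(1) car by blast
  qed
qed

section \<open>The structure group and the structure skew brace of a solution\<close>

definition structure_relations ::
    "'a set \<Rightarrow> ('a \<times> 'a \<Rightarrow> 'a \<times> 'a) \<Rightarrow> ('a gword \<times> 'a gword) set" where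
  "structure_relations X r =
     {([(True, x), (True, y)], [(True, lam r x y), (True, rho r y x)]) | x y. x \<in> X \<and> y \<in> X}"

definition structure_group :: "'a set \<Rightarrow> ('a \<times> 'a \<Rightarrow> 'a \<times> 'a) \<Rightarrow> 'a gword set monoid" where
  "structure_group X r = presented_group X (structure_relations X r)"

definition canonical_map :: "'a set \<Rightarrow> ('a \<times> 'a \<Rightarrow> 'a \<times> 'a) \<Rightarrow> 'a \<Rightarrow> 'a gword set" where
  "canonical_map X r x = pres_class X (structure_relations X r) [(True, x)]"

definition injective_solution :: "'a set \<Rightarrow> ('a \<times> 'a \<Rightarrow> 'a \<times> 'a) \<Rightarrow> bool" where
  "injective_solution X r \<longleftrightarrow> inj_on (canonical_map X r) X"

text \<open>The structure skew brace of a solution exists and is unique, so it can be introduced by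
  its defining property; \<open>monoid.truncate B\<close> is the multiplicative group of \<open>B\<close>.\<close>

definition is_structure_skew_brace ::
    "'a set \<Rightarrow> ('a \<times> 'a \<Rightarrow> 'a \<times> 'a) \<Rightarrow> 'a gword set ring \<Rightarrow> bool" where
  "is_structure_skew_brace X r B \<longleftrightarrow>
     skew_brace B \<and>
     monoid.truncate B = structure_group X r \<and>
     (\<forall>p \<in> X \<times> X.
        associated_map B (map_prod (canonical_map X r) (canonical_map X r) p) =
        map_prod (canonical_map X r) (canonical_map X r) (r p))"

end

theory Submission
  imports Defs "HOL-Algebra.Generated_Groups"
begin

text \<open>
  Both properties are about finiteness of orbits. In a skew brace \<open>B\<close> the maps \<open>\<theta>\<^bsub>(a,b)\<^esub>\<close> are
  automorphisms of the additive group. Hence the orbit of a sum lies in the sum of the orbits, and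
  \<open>B\<close> is \<open>\<theta>\<^sub>f\<close> as soon as every element of some additive generating set has a finite orbit. For the
  structure skew brace, \<open>\<iota>(X)\<close> is such a generating set: it generates the multiplicative group by construction, and the additive group because it is mapped onto itself by every
  \<open>\<lambda>\<^sub>g\<close> (lemma \<open>additive_generation\<close>).

  For a solution, a subset \<open>Y\<close> of \<open>X\<close> is a decomposition factor exactly if membership in \<open>Y\<close> is
  preserved and reflected by all \<open>\<lambda>\<^sub>x\<close> and \<open>\<rho>\<^sub>x\<close> with \<open>x\<close> in \<open>X\<close>
  (lemma \<open>decomposition_factor_iff_invariant\<close>).
  The link between the two sides is that these maps are visible in \<open>B\<close>: \<open>\<lambda>\<close> restricts to
  \<open>\<lambda>\<^bsub>\<iota>(x)\<^esub>(\<iota>(y)) = \<iota>(\<lambda>\<^sub>x(y))\<close>, and \<open>\<rho>\<close> is additive conjugation up to \<open>\<lambda>\<close>,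
  \<open>-\<iota>(w) + \<iota>(y) + \<iota>(w) = \<iota>(\<lambda>\<^sub>w(\<rho>\<^sub>u(y)))\<close> with \<open>w = \<lambda>\<^sub>y(u)\<close> (lemma \<open>canonical_conjugate\<close>).

  So if \<open>Y\<close> is a finite decomposition factor, \<open>\<iota>(Y)\<close> is a finite set stable under \<open>\<lambda>\<close> and under
  conjugation by generators, hence under all of \<open>\<theta>\<close>, and it contains the orbits of its elements.
  Conversely, the maps \<open>\<theta>\<^bsub>(a,b)\<^esub>\<close> are closed under composition (lemma \<open>theta_theta\<close>), so an orbit is
  neither entered nor left by \<open>\<lambda>\<close> and by conjugations. Therefore the preimage under \<open>\<iota>\<close> of a
  \<open>\<theta>\<close>-orbit is always a decomposition factor; it is finite if the orbit is finite and \<open>\<iota>\<close> is injective.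
\<close>

section \<open>Decomposition factors as invariant subsets\<close>

definition invariant_subset :: "'a set \<Rightarrow> ('a \<times> 'a \<Rightarrow> 'a \<times> 'a) \<Rightarrow> 'a set \<Rightarrow> bool" where
  "invariant_subset X r Y \<longleftrightarrow> Y \<subseteq> X \<and>
     (\<forall>x\<in>X. \<forall>y\<in>X. (lam r x y \<in> Y \<longleftrightarrow> y \<in> Y) \<and> (rho r x y \<in> Y \<longleftrightarrow> y \<in> Y))"

lemma invariant_subset_Diff:
  assumes "solution X r" and "invariant_subset X r Y"
  shows "invariant_subset X r (X - Y)"
proof -
  have "lam r x y \<in> X \<and> rho r x y \<in> X" if "x \<in> X" "y \<in> X" for x y
    using assms(1) that unfolding solution_def by (metis bij_betwE)
  then show ?thesis using assms(2) by (simp add: invariant_subset_def)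
qed

lemma bij_betw_restrict:
  assumes "bij_betw f A A" and "Y \<subseteq> A" and "\<And>x. x \<in> A \<Longrightarrow> f x \<in> Y \<longleftrightarrow> x \<in> Y"
  shows "bij_betw f Y Y"
proof (rule bij_betw_subset[OF assms(1,2)])
  show "f ` Y = Y"
  proof
    show "f ` Y \<subseteq> Y" using assms(2,3) by blast
    show "Y \<subseteq> f ` Y"
    proof
      fix y assume y: "y \<in> Y"
      then obtain x where "x \<in> A" "y = f x"
        using assms(1,2) by (metis bij_betw_def imageE subsetD)
      then show "y \<in> f ` Y" using assms(3) y by simp
    qed
  qed
qed

lemma invariant_subset_solution:
  assumes sol: "solution X r" and inv: "invariant_subset X r Y" and "Y \<noteq> {}"
  shows "solution Y r"
proof -
  have sub: "Y \<subseteq> X"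
    and lam_iff: "\<And>x y. x \<in> X \<Longrightarrow> y \<in> X \<Longrightarrow> lam r x y \<in> Y \<longleftrightarrow> y \<in> Y"
    and rho_iff: "\<And>x y. x \<in> X \<Longrightarrow> y \<in> X \<Longrightarrow> rho r x y \<in> Y \<longleftrightarrow> y \<in> Y"
    using inv unfolding invariant_subset_def by blast+
  have "r p \<in> Y \<times> Y \<longleftrightarrow> p \<in> Y \<times> Y" if "p \<in> X \<times> X" for p
    using that lam_iff rho_iff by (cases p) (auto simp: lam_def rho_def mem_Times_iff)
  then have r: "bij_betw r (Y \<times> Y) (Y \<times> Y)"
  proof (rule bij_betw_restrict[rotated 2])
    show "bij_betw r (X \<times> X) (X \<times> X)" using sol by (simp add: solution_def)
    show "Y \<times> Y \<subseteq> X \<times> X" using sub by blast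
  qed
  have "bij_betw (lam r x) Y Y \<and> bij_betw (rho r x) Y Y" if "x \<in> Y" for x
  proof
    have x: "x \<in> X" using that sub by blast
    then have "bij_betw (lam r x) X X" "bij_betw (rho r x) X X"
      using sol by (simp_all add: solution_def)
    then show "bij_betw (lam r x) Y Y" "bij_betw (rho r x) Y Y"
      using sub lam_iff[OF x] rho_iff[OF x] by (blast intro: bij_betw_restrict)+
  qed
  then show ?thesis
    using sol sub r \<open>Y \<noteq> {}\<close> unfolding solution_def by blast
qed

lemma bij_betw_parts_iff:
  assumes f: "bij_betw f (Y \<union> Z) (Y \<union> Z)" and disj: "Y \<inter> Z = {}"
    and part: "bij_betw f Y Y \<or> bij_betw f Z Z" and x: "x \<in> Y \<union> Z"
  shows "f x \<in> Y \<longleftrightarrow> x \<in> Y"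
proof -
  have *: "f x \<in> A \<longleftrightarrow> x \<in> A" if "bij_betw f A A" "A \<subseteq> Y \<union> Z" for A
  proof
    assume "f x \<in> A"
    then have "f x \<in> f ` A" using that(1) by (simp add: bij_betw_def)
    moreover have "inj_on f (Y \<union> Z)" using f by (simp add: bij_betw_def)
    ultimately show "x \<in> A" using x that(2) by (simp only: inj_on_image_mem_iff)
  next
    assume "x \<in> A"
    then have "f x \<in> f ` A" by (rule imageI)
    then show "f x \<in> A" using that(1) by (simp add: bij_betw_def)
  qed
  have "f x \<in> Y \<union> Z" using f x by (auto simp: bij_betw_def)
  then show ?thesis using part *[of Y] *[of Z] x disj by auto
qed

text \<open>If \<open>x\<close> lies in the part \<open>Z\<close>, nothing is assumed directly about the effect of \<open>\<lambda>\<^sub>x\<close> on \<open>Y\<close>;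
  but it permutes \<open>X\<close> and \<open>Z\<close>, hence also the complement \<open>Y\<close> of \<open>Z\<close>. For the converse, invariance
  passes to the complement, and the solution axioms restrict to any non-empty invariant subset.\<close>

lemma decomposition_factor_iff_invariant:
  assumes sol: "solution X r"
  shows "decomposition_factor X r Y \<longleftrightarrow> invariant_subset X r Y"
proof
  assume "decomposition_factor X r Y"
  then obtain Z where X: "X = Y \<union> Z" and disj: "Y \<inter> Z = {}"
    and Y: "Y = {} \<or> solution Y r" and Z: "Z = {} \<or> solution Z r"
    unfolding decomposition_factor_def decomposition_def subsolution_def by blast
  have "(lam r x y \<in> Y \<longleftrightarrow> y \<in> Y) \<and> (rho r x y \<in> Y \<longleftrightarrow> y \<in> Y)"
    if "x \<in> X" "y \<in> X" for x y
    using that sol Y Z disj unfolding solution_def X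
    by (intro conjI bij_betw_parts_iff[of _ Y Z]) blast+
  then show "invariant_subset X r Y" unfolding invariant_subset_def X by blast
next
  assume inv: "invariant_subset X r Y"
  then have "Y \<subseteq> X" by (simp add: invariant_subset_def)
  then have "decomposition X r Y (X - Y)"
    unfolding decomposition_def subsolution_def
    using invariant_subset_solution[OF sol inv]
      invariant_subset_solution[OF sol invariant_subset_Diff[OF sol inv]] by blast
  then show "decomposition_factor X r Y" unfolding decomposition_factor_def by blast
qed

section \<open>The actions of a skew brace on its additive group\<close>

lemma (in group) setwise_stabilizer_subgroup:
  assumes one: "\<And>s. s \<in> S \<Longrightarrow> \<phi> \<one> s = s"
    and mult: "\<And>g h s. g \<in> carrier G \<Longrightarrow> h \<in> carrier G \<Longrightarrow> s \<in> S \<Longrightarrow> \<phi> (g \<otimes> h) s = \<phi> g (\<phi> h s)"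
  shows "subgroup {g \<in> carrier G. \<phi> g ` S = S} G"
proof
  show "{g \<in> carrier G. \<phi> g ` S = S} \<subseteq> carrier G" by blast
  have "\<phi> \<one> ` S = id ` S" using one by (intro image_cong) auto
  then show "\<one> \<in> {g \<in> carrier G. \<phi> g ` S = S}" by simp
next
  fix g h assume gh: "g \<in> {g \<in> carrier G. \<phi> g ` S = S}" "h \<in> {g \<in> carrier G. \<phi> g ` S = S}"
  have "\<phi> (g \<otimes> h) ` S = \<phi> g ` \<phi> h ` S"
    unfolding image_image using gh mult by (intro image_cong) auto
  then show "g \<otimes> h \<in> {g \<in> carrier G. \<phi> g ` S = S}" using gh by auto
next
  fix g assume g: "g \<in> {g \<in> carrier G. \<phi> g ` S = S}"
  have "\<phi> (inv g) (\<phi> g s) = s" if "s \<in> S" for s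
    using that g mult[of "inv g" g s] one by (auto simp: l_inv)
  then have "\<phi> (inv g) ` \<phi> g ` S = id ` S"
    unfolding image_image by (intro image_cong) auto
  then show "inv g \<in> {g \<in> carrier G. \<phi> g ` S = S}" using g by auto
qed

locale skew_brace_structure =
  fixes B :: "('b, 'm) ring_scheme" (structure)
  assumes skew_brace: "skew_brace B"

sublocale skew_brace_structure \<subseteq> add: group "add_monoid B"
  rewrites "carrier (add_monoid B) = carrier B"
    and "mult (add_monoid B) = add B"
    and "one (add_monoid B) = zero B"
    and "m_inv (add_monoid B) = a_inv B"
  using skew_brace by (auto simp: skew_brace_def a_inv_def)

sublocale skew_brace_structure \<subseteq> mult: group B
  using skew_brace by (simp add: skew_brace_def)

context skew_brace_structure
begin

lemma add_cancel [simp]: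
  assumes "a \<in> carrier B" "b \<in> carrier B"
  shows "\<ominus> a \<oplus> (a \<oplus> b) = b" "a \<oplus> (\<ominus> a \<oplus> b) = b"
  using assms by (simp_all add: add.m_assoc[symmetric])

lemma distrib:
  "a \<in> carrier B \<Longrightarrow> b \<in> carrier B \<Longrightarrow> c \<in> carrier B \<Longrightarrow>
    a \<otimes> (b \<oplus> c) = (a \<otimes> b) \<oplus> (\<ominus> a \<oplus> (a \<otimes> c))"
  using skew_brace by (simp add: skew_brace_def add.m_assoc)

lemma mult_zero:
  assumes "a \<in> carrier B" shows "a \<otimes> \<zero> = a"
proof -
  have "a \<otimes> \<zero> \<oplus> (\<ominus> a \<oplus> a \<otimes> \<zero>) = a \<otimes> \<zero> \<oplus> \<zero>"
    using distrib[of a \<zero> \<zero>] assms by simp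
  then have "\<ominus> a \<oplus> a \<otimes> \<zero> = \<zero>" using assms by (simp del: add.r_one)
  then show ?thesis using assms add_cancel(2)[of a "a \<otimes> \<zero>"] by simp
qed

lemma one_eq_zero: "\<one> = \<zero>"
  using mult_zero[of \<one>] by simp

lemma lam_closed [simp]: "a \<in> carrier B \<Longrightarrow> b \<in> carrier B \<Longrightarrow> sb_lam B a b \<in> carrier B"
  by (simp add: sb_lam_def)

lemma mult_eq_add_lam: "a \<in> carrier B \<Longrightarrow> b \<in> carrier B \<Longrightarrow> a \<otimes> b = a \<oplus> sb_lam B a b"
  by (simp add: sb_lam_def)

lemma lam_add:
  "a \<in> carrier B \<Longrightarrow> b \<in> carrier B \<Longrightarrow> c \<in> carrier B \<Longrightarrow>
    sb_lam B a (b \<oplus> c) = sb_lam B a b \<oplus> sb_lam B a c"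
  by (simp add: sb_lam_def distrib add.m_assoc)

lemma lam_zero: "a \<in> carrier B \<Longrightarrow> sb_lam B a \<zero> = \<zero>"
  by (simp add: sb_lam_def mult_zero)

lemma lam_neg:
  assumes "a \<in> carrier B" "b \<in> carrier B"
  shows "sb_lam B a (\<ominus> b) = \<ominus> sb_lam B a b"
proof -
  have "sb_lam B a (\<ominus> b) \<oplus> sb_lam B a b = \<zero>"
    using assms lam_add[of a "\<ominus> b" b] by (simp add: lam_zero)
  then show ?thesis using assms by (intro add.inv_equality[symmetric]) auto
qed

lemma lam_one: "b \<in> carrier B \<Longrightarrow> sb_lam B \<one> b = b"
  by (simp add: sb_lam_def) (simp add: one_eq_zero)

lemma lam_mult:
  assumes "a \<in> carrier B" "b \<in> carrier B" "c \<in> carrier B"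
  shows "sb_lam B (a \<otimes> b) c = sb_lam B a (sb_lam B b c)"
proof -
  have "(a \<otimes> b) \<oplus> sb_lam B (a \<otimes> b) c = a \<otimes> (b \<otimes> c)"
    using assms by (simp add: mult_eq_add_lam[symmetric] mult.m_assoc)
  also have "\<dots> = a \<oplus> (sb_lam B a b \<oplus> sb_lam B a (sb_lam B b c))"
    using assms by (simp add: mult_eq_add_lam lam_add)
  also have "\<dots> = (a \<otimes> b) \<oplus> sb_lam B a (sb_lam B b c)"
    using assms by (simp add: mult_eq_add_lam add.m_assoc)
  finally show ?thesis using assms by simp
qed

lemma lam_inv_lam:
  "a \<in> carrier B \<Longrightarrow> b \<in> carrier B \<Longrightarrow> sb_lam B (inv a) (sb_lam B a b) = b"
  by (simp add: lam_mult[symmetric] lam_one)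

lemma lam_stabilizer_subgroup:
  assumes "S \<subseteq> carrier B"
  shows "subgroup {g \<in> carrier B. sb_lam B g ` S = S} B"
  by (rule mult.setwise_stabilizer_subgroup)
     (use assms in \<open>auto simp: lam_one lam_mult\<close>)

lemma conjugation_stabilizer_subgroup:
  assumes "S \<subseteq> carrier B"
  shows "subgroup {g \<in> carrier B. (\<lambda>s. g \<oplus> s \<oplus> \<ominus> g) ` S = S} (add_monoid B)"
proof (rule add.setwise_stabilizer_subgroup)
  show "\<zero> \<oplus> s \<oplus> \<ominus> \<zero> = s" if "s \<in> S" for s
    using assms that by auto
  show "(g \<oplus> h) \<oplus> s \<oplus> \<ominus> (g \<oplus> h) = g \<oplus> (h \<oplus> s \<oplus> \<ominus> h) \<oplus> \<ominus> g"
    if "g \<in> carrier B" "h \<in> carrier B" "s \<in> S" for g h s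
    using assms that by (simp add: add.m_assoc add.inv_mult_group subset_iff)
qed

text \<open>Let \<open>H\<close> be the additive subgroup generated by \<open>S\<close>. The elements whose whole \<open>\<lambda>\<close>-orbit lies in
  \<open>H\<close> form an additive subgroup that is stable under \<open>\<lambda>\<close>. Since \<open>a \<circ> b = a + \<lambda>\<^sub>a(b)\<close>, such a
  subgroup is also multiplicative, and it contains the multiplicative generators \<open>S\<close>.\<close>

lemma additive_generation:
  assumes S: "S \<subseteq> carrier B" and gen: "generate B S = carrier B"
    and stable: "\<And>g s. g \<in> carrier B \<Longrightarrow> s \<in> S \<Longrightarrow> sb_lam B g s \<in> S"
  shows "generate (add_monoid B) S = carrier B"
proof -
  let ?H = "generate (add_monoid B) S"
  let ?K = "{h \<in> carrier B. \<forall>g \<in> carrier B. sb_lam B g h \<in> ?H}"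
  have H: "subgroup ?H (add_monoid B)" using add.generate_is_subgroup S by simp
  have H_add: "x \<oplus> y \<in> ?H" if "x \<in> ?H" "y \<in> ?H" for x y
    using subgroup.m_closed[OF H that] by simp
  have H_neg: "\<ominus> x \<in> ?H" if "x \<in> ?H" for x
    using subgroup.m_inv_closed[OF H that] by (simp add: a_inv_def)
  have H_zero: "\<zero> \<in> ?H" using subgroup.one_closed[OF H] by simp
  have "subgroup ?K B"
  proof
    show "?K \<subseteq> carrier B" by blast
    show "\<one> \<in> ?K" using H_zero by (auto simp: one_eq_zero lam_zero)
  next
    fix a b assume "a \<in> ?K" "b \<in> ?K"
    then show "a \<otimes> b \<in> ?K"
      using H_add by (auto simp: mult_eq_add_lam[of a b] lam_add lam_mult[symmetric])
  next
    fix a assume a: "a \<in> ?K"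
    then have "a \<oplus> sb_lam B a (inv a) = \<zero>"
      using mult_eq_add_lam[of a "inv a"] by (simp add: one_eq_zero)
    then have "sb_lam B a (inv a) = \<ominus> a"
      using a add_cancel(1)[of a "sb_lam B a (inv a)"] by simp
    then have "inv a = sb_lam B (inv a) (\<ominus> a)"
      using a lam_inv_lam[of a "inv a"] by simp
    then have "sb_lam B g (inv a) = \<ominus> sb_lam B (g \<otimes> inv a) a" if "g \<in> carrier B" for g
      using a that by (metis (no_types, lifting) add.inv_closed lam_mult lam_neg mem_Collect_eq
          mult.inv_closed mult.m_closed)
    then show "inv a \<in> ?K" using a H_neg by auto
  qed
  moreover have "S \<subseteq> ?K" using S stable by (auto intro: generate.incl)
  ultimately have "carrier B \<subseteq> ?K"
    using mult.generate_subgroup_incl[of S ?K] gen by simp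
  then have "carrier B \<subseteq> ?H" using lam_one mult.one_closed by fastforce
  moreover have "?H \<subseteq> carrier B" using subgroup.subset[OF H] by simp
  ultimately show ?thesis by blast
qed

definition theta_orbit :: "'b \<Rightarrow> 'b set" where
  "theta_orbit x = {sb_theta B (a, b) x | a b. a \<in> carrier B \<and> b \<in> carrier B}"

lemma theta_f_iff: "theta_f_skew_brace B \<longleftrightarrow> (\<forall>x \<in> carrier B. finite (theta_orbit x))"
  using skew_brace by (simp add: theta_f_skew_brace_def theta_orbit_def)

lemma theta_add:
  assumes "a \<in> carrier B" "b \<in> carrier B" "c \<in> carrier B" "d \<in> carrier B"
  shows "sb_theta B (a, b) (c \<oplus> d) = sb_theta B (a, b) c \<oplus> sb_theta B (a, b) d"
  using assms by (simp add: sb_theta_def lam_add add.m_assoc)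

lemma theta_neg:
  assumes "a \<in> carrier B" "b \<in> carrier B" "c \<in> carrier B"
  shows "sb_theta B (a, b) (\<ominus> c) = \<ominus> sb_theta B (a, b) c"
  using assms by (simp add: sb_theta_def lam_neg add.m_assoc add.inv_mult_group)

text \<open>The composition law of the semidirect product of the additive group by the multiplicative
  group acting through \<open>\<lambda>\<close>.\<close>

lemma theta_theta:
  assumes "a \<in> carrier B" "b \<in> carrier B" "c \<in> carrier B" "d \<in> carrier B" "x \<in> carrier B"
  shows "sb_theta B (a, b) (sb_theta B (c, d) x) = sb_theta B (a \<oplus> sb_lam B b c, b \<otimes> d) x"
  using assms by (simp add: sb_theta_def lam_add lam_neg lam_mult add.m_assoc add.inv_mult_group)

lemma theta_orbit_stable:
  assumes x: "x \<in> carrier B" and y: "y \<in> theta_orbit x" and ab: "a \<in> carrier B" "b \<in> carrier B"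
  shows "sb_theta B (a, b) y \<in> theta_orbit x"
proof -
  obtain c d where cd: "c \<in> carrier B" "d \<in> carrier B" and y: "y = sb_theta B (c, d) x"
    using y unfolding theta_orbit_def by blast
  show ?thesis
    unfolding y theta_theta[OF ab cd x] theta_orbit_def using ab cd
    by (blast intro: add.m_closed mult.m_closed lam_closed)
qed

lemma theta_orbit_self: "x \<in> carrier B \<Longrightarrow> x \<in> theta_orbit x"
proof -
  assume x: "x \<in> carrier B"
  then have "x = sb_theta B (\<zero>, \<one>) x" by (simp add: sb_theta_def lam_one)
  then show ?thesis unfolding theta_orbit_def using add.one_closed mult.one_closed by blast
qed

lemma theta_zero_left: "g \<in> carrier B \<Longrightarrow> y \<in> carrier B \<Longrightarrow> sb_theta B (\<zero>, g) y = sb_lam B g y"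
  by (simp add: sb_theta_def)

lemma theta_one_right:
  "g \<in> carrier B \<Longrightarrow> y \<in> carrier B \<Longrightarrow> sb_theta B (g, \<one>) y = g \<oplus> y \<oplus> \<ominus> g"
  by (simp add: sb_theta_def lam_one)

lemma lam_in_theta_orbit_iff:
  assumes x: "x \<in> carrier B" and g: "g \<in> carrier B" and y: "y \<in> carrier B"
  shows "sb_lam B g y \<in> theta_orbit x \<longleftrightarrow> y \<in> theta_orbit x"
proof
  assume "sb_lam B g y \<in> theta_orbit x"
  from theta_orbit_stable[OF x this, of \<zero> "inv g"] show "y \<in> theta_orbit x"
    using g y by (simp add: theta_zero_left lam_inv_lam)
next
  assume "y \<in> theta_orbit x"
  from theta_orbit_stable[OF x this, of \<zero> g] show "sb_lam B g y \<in> theta_orbit x"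
    using g y by (simp add: theta_zero_left)
qed

lemma conjugate_in_theta_orbit_iff:
  assumes x: "x \<in> carrier B" and g: "g \<in> carrier B" and y: "y \<in> carrier B"
  shows "\<ominus> g \<oplus> y \<oplus> g \<in> theta_orbit x \<longleftrightarrow> y \<in> theta_orbit x"
proof
  assume "\<ominus> g \<oplus> y \<oplus> g \<in> theta_orbit x"
  from theta_orbit_stable[OF x this, of g \<one>] show "y \<in> theta_orbit x"
    using g y by (simp add: theta_one_right add.m_assoc)
next
  assume "y \<in> theta_orbit x"
  from theta_orbit_stable[OF x this, of "\<ominus> g" \<one>] show "\<ominus> g \<oplus> y \<oplus> g \<in> theta_orbit x"
    using g y by (simp add: theta_one_right)
qed

text \<open>The elements with finite orbit form an additive subgroup, because \<open>\<theta>\<close> acts by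
  automorphisms.\<close>

lemma theta_f_skew_braceI:
  assumes S: "S \<subseteq> carrier B" and gen: "generate (add_monoid B) S = carrier B"
    and fin: "\<And>s. s \<in> S \<Longrightarrow> finite (theta_orbit s)"
  shows "theta_f_skew_brace B"
proof -
  let ?F = "{x \<in> carrier B. finite (theta_orbit x)}"
  have "subgroup ?F (add_monoid B)"
  proof (rule add.subgroupI, goal_cases)
    case 1
    then show ?case by auto
  next
    case 2
    have "theta_orbit \<zero> \<subseteq> {\<zero>}"
      by (auto simp: theta_orbit_def sb_theta_def lam_zero)
    then have "finite (theta_orbit \<zero>)" by (rule finite_subset) simp
    then show ?case using add.one_closed by blast
  next
    case (3 x)
    have "theta_orbit (\<ominus> x) \<subseteq> a_inv B ` theta_orbit x"
      using 3 by (force simp: theta_orbit_def theta_neg)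
    then have "finite (theta_orbit (\<ominus> x))" using 3 by (auto intro: finite_subset)
    then show ?case using 3 by simp
  next
    case (4 x y)
    have "theta_orbit (x \<oplus> y) \<subseteq> (\<lambda>(u, v). u \<oplus> v) ` (theta_orbit x \<times> theta_orbit y)"
      using 4 by (force simp: theta_orbit_def theta_add)
    then have "finite (theta_orbit (x \<oplus> y))" using 4 by (auto intro: finite_subset)
    then show ?case using 4 by simp
  qed
  moreover have "S \<subseteq> ?F" using S fin by blast
  ultimately have "carrier B \<subseteq> ?F"
    using add.generate_subgroup_incl[of S ?F] gen by simp
  then show ?thesis unfolding theta_f_iff by blast
qed

end

section \<open>The structure skew brace\<close>

locale structure_skew_brace = skew_brace_structure B for B :: "'a gword set ring" (structure) +
  fixes X :: "'a set" and r :: "'a \<times> 'a \<Rightarrow> 'a \<times> 'a"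
  assumes sol: "solution X r" and struct: "is_structure_skew_brace X r B"
begin

abbreviation \<iota> :: "'a \<Rightarrow> 'a gword set" where
  "\<iota> \<equiv> canonical_map X r"

abbreviation cls :: "'a gword \<Rightarrow> 'a gword set" where
  "cls \<equiv> pres_class X (structure_relations X r)"

lemma carrier_eq: "carrier B = cls ` gwords X"
  and mult_cls: "u \<in> gwords X \<Longrightarrow> v \<in> gwords X \<Longrightarrow> cls u \<otimes> cls v = cls (u @ v)"
  and one_eq_cls: "\<one> = cls []"
proof -
  let ?P = "presented_group X (structure_relations X r)"
  have "monoid.truncate B = ?P"
    using struct by (simp add: is_structure_skew_brace_def structure_group_def)
  moreover have "carrier (monoid.truncate B) = carrier B"
    "mult (monoid.truncate B) = mult B" "one (monoid.truncate B) = one B"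
    by (simp_all add: monoid.defs)
  ultimately have "carrier B = carrier ?P" and mult: "mult B = mult ?P" and "one B = one ?P"
    by simp_all
  then show "carrier B = cls ` gwords X" "\<one> = cls []"
    by (simp_all add: presented_group_def)
  show "u \<in> gwords X \<Longrightarrow> v \<in> gwords X \<Longrightarrow> cls u \<otimes> cls v = cls (u @ v)"
    unfolding mult by (rule presented_group_mult)
qed

lemma canonical_closed [simp]: "x \<in> X \<Longrightarrow> \<iota> x \<in> carrier B"
  unfolding carrier_eq canonical_map_def by (rule imageI) simp

lemma canonical_generates: "generate B (\<iota> ` X) = carrier B"
proof
  show "generate B (\<iota> ` X) \<subseteq> carrier B"
    by (rule mult.generate_incl) auto
  have "cls w \<in> generate B (\<iota> ` X)" if "w \<in> gwords X" for w
    using that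
  proof (induction w rule: lists.induct)
    case Nil
    then show ?case using generate.one[of B] by (simp add: one_eq_cls)
  next
    case (Cons l w)
    obtain b x where l: "l = (b, x)" by force
    have x: "x \<in> X" and w: "w \<in> gwords X" using Cons.hyps l by auto
    have letter: "cls [(b, x)] \<in> generate B (\<iota> ` X)"
    proof (cases b)
      case True
      then show ?thesis using x by (auto simp: canonical_map_def intro: generate.incl)
    next
      case False
      have letter_closed: "cls [(False, x)] \<in> carrier B"
        unfolding carrier_eq using x by (intro imageI) simp
      have "cls [(False, x)] \<otimes> \<iota> x = cls [(False, x), (True, x)]"
        using x by (simp add: canonical_map_def mult_cls)
      also have "\<dots> = \<one>"
        using x pres_eq.cancel[of x X _ False] by (simp add: one_eq_cls pres_class_eq_iff)
      finally have "inv (\<iota> x) = cls [(False, x)]"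
        using x letter_closed by (intro mult.inv_equality) auto
      then show ?thesis using False x generate.inv[of "\<iota> x" "\<iota> ` X" B] by simp
    qed
    have "cls (l # w) = cls [(b, x)] \<otimes> cls w"
      using x w l by (simp add: mult_cls)
    then show ?case using generate.eng[OF letter Cons.IH] by simp
  qed
  then show "carrier B \<subseteq> generate B (\<iota> ` X)" unfolding carrier_eq by blast
qed

lemma lam_rho_closed:
  assumes "x \<in> X" "y \<in> X" shows "lam r x y \<in> X" "rho r x y \<in> X"
  using sol assms unfolding solution_def by (metis bij_betwE)+

lemma associated_canonical:
  assumes "x \<in> X" "y \<in> X"
  shows "associated_map B (\<iota> x, \<iota> y) = (\<iota> (lam r x y), \<iota> (rho r y x))"
proof -
  have "(x, y) \<in> X \<times> X" using assms by simp
  then have "associated_map B (map_prod \<iota> \<iota> (x, y)) = map_prod \<iota> \<iota> (r (x, y))"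
    using struct unfolding is_structure_skew_brace_def by blast
  then show ?thesis by (simp add: lam_def rho_def map_prod_def split_beta)
qed

lemma lam_canonical:
  "x \<in> X \<Longrightarrow> y \<in> X \<Longrightarrow> sb_lam B (\<iota> x) (\<iota> y) = \<iota> (lam r x y)"
  using associated_canonical[of x y] by (simp add: associated_map_def)

lemma mult_canonical:
  assumes xy: "x \<in> X" "y \<in> X"
  shows "\<iota> (lam r x y) \<otimes> \<iota> (rho r y x) = \<iota> x \<otimes> \<iota> y"
proof -
  have "inv (\<iota> (lam r x y)) \<otimes> \<iota> x \<otimes> \<iota> y = \<iota> (rho r y x)"
    using associated_canonical[OF xy] lam_canonical[OF xy] by (simp add: associated_map_def)
  then show ?thesis
    using xy lam_rho_closed[of x y]
    by (metis canonical_closed mult.inv_closed mult.inv_solve_left mult.m_assoc mult.m_closed)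
qed

text \<open>Both sides of the defining relation \<open>\<iota>(y) \<circ> \<iota>(u) = \<iota>(w) \<circ> \<iota>(\<rho>\<^sub>u(y))\<close> are expanded with
  \<open>a \<circ> b = a + \<lambda>\<^sub>a(b)\<close>. As \<open>\<lambda>\<^sub>y\<close> is a permutation, every \<open>w\<close> in \<open>X\<close> has the required form, so
  this describes all conjugations among generators.\<close>

lemma canonical_conjugate:
  assumes y: "y \<in> X" and u: "u \<in> X" and w: "w = lam r y u"
  shows "\<ominus> \<iota> w \<oplus> \<iota> y \<oplus> \<iota> w = \<iota> (lam r w (rho r u y))"
proof -
  have wX: "w \<in> X" and v: "rho r u y \<in> X" using y u w lam_rho_closed by auto
  have "\<iota> y \<oplus> \<iota> w = \<iota> w \<oplus> \<iota> (lam r w (rho r u y))"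
    using mult_canonical[OF y u] y u wX v w by (simp add: mult_eq_add_lam lam_canonical)
  then show ?thesis
    using y wX v lam_rho_closed(1)[OF wX v] by (simp add: add.m_assoc)
qed

lemma lam_image_invariant:
  assumes inv: "invariant_subset X r Y" and g: "g \<in> carrier B"
  shows "sb_lam B g ` \<iota> ` Y = \<iota> ` Y"
proof -
  have Y: "Y \<subseteq> X" using inv by (simp add: invariant_subset_def)
  let ?K = "{g \<in> carrier B. sb_lam B g ` \<iota> ` Y = \<iota> ` Y}"
  have "\<iota> x \<in> ?K" if x: "x \<in> X" for x
  proof -
    have "bij_betw (lam r x) Y Y"
    proof (rule bij_betw_restrict)
      show "bij_betw (lam r x) X X" using sol x by (simp add: solution_def)
    qed (use inv x in \<open>simp_all add: invariant_subset_def\<close>)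
    then have "\<iota> ` lam r x ` Y = \<iota> ` Y" by (simp add: bij_betw_def)
    moreover have "sb_lam B (\<iota> x) ` \<iota> ` Y = \<iota> ` lam r x ` Y"
      unfolding image_image using x Y by (intro image_cong) (auto simp: lam_canonical)
    ultimately show ?thesis using x by simp
  qed
  moreover have "subgroup ?K B" using Y by (intro lam_stabilizer_subgroup) auto
  ultimately have "generate B (\<iota> ` X) \<subseteq> ?K"
    by (intro mult.generate_subgroup_incl) blast+
  then show ?thesis using g unfolding canonical_generates by blast
qed

lemma canonical_generates_additively: "generate (add_monoid B) (\<iota> ` X) = carrier B"
proof (rule additive_generation[OF _ canonical_generates])
  have "invariant_subset X r X"
    unfolding invariant_subset_def using lam_rho_closed by blast
  then show "\<And>g s. g \<in> carrier B \<Longrightarrow> s \<in> \<iota> ` X \<Longrightarrow> sb_lam B g s \<in> \<iota> ` X"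
    using lam_image_invariant by blast
qed auto

text \<open>The conjugation formula only shows that \<open>s \<mapsto> -\<iota>(w) + s + \<iota>(w)\<close> maps \<open>\<iota>(Y)\<close> into itself;
  finiteness of \<open>Y\<close> makes this injective map surjective, so that \<open>\<iota>(w)\<close> lies in the stabilizer,
  which is a subgroup.\<close>

lemma conjugation_image_invariant:
  assumes inv: "invariant_subset X r Y" and fin: "finite Y" and g: "g \<in> carrier B"
  shows "(\<lambda>s. g \<oplus> s \<oplus> \<ominus> g) ` \<iota> ` Y = \<iota> ` Y"
proof -
  have Y: "Y \<subseteq> X" using inv by (simp add: invariant_subset_def)
  let ?K = "{g \<in> carrier B. (\<lambda>s. g \<oplus> s \<oplus> \<ominus> g) ` \<iota> ` Y = \<iota> ` Y}"
  have K: "subgroup ?K (add_monoid B)" using Y by (intro conjugation_stabilizer_subgroup) auto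
  have "\<iota> w \<in> ?K" if w: "w \<in> X" for w
  proof -
    let ?c = "\<lambda>s. \<ominus> \<iota> w \<oplus> s \<oplus> \<ominus> (\<ominus> \<iota> w)"
    have "?c (\<iota> y) \<in> \<iota> ` Y" if y: "y \<in> Y" for y
    proof -
      have "bij_betw (lam r y) X X" using sol y Y by (auto simp: solution_def)
      then obtain u where u: "u \<in> X" "w = lam r y u" using w by (auto simp: bij_betw_def)
      have "rho r u y \<in> Y" "rho r u y \<in> X" "lam r w (rho r u y) \<in> Y"
        using inv u y Y w lam_rho_closed by (auto simp: invariant_subset_def)
      then show ?thesis using canonical_conjugate[of y u w] u y Y w by auto
    qed
    then have "?c ` \<iota> ` Y \<subseteq> \<iota> ` Y" by blast
    moreover have "inj_on ?c (\<iota> ` Y)"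
    proof (rule inj_on_inverseI)
      show "\<iota> w \<oplus> ?c s \<oplus> \<ominus> \<iota> w = s" if "s \<in> \<iota> ` Y" for s
        using that w subsetD[OF Y] by (auto simp: add.m_assoc)
    qed
    ultimately have "?c ` \<iota> ` Y = \<iota> ` Y" using fin by (intro endo_inj_surj) auto
    then have "\<ominus> \<iota> w \<in> ?K" using w by simp
    from subgroup.m_inv_closed[OF K this, folded a_inv_def] show ?thesis
      using w by simp
  qed
  then have "generate (add_monoid B) (\<iota> ` X) \<subseteq> ?K"
    using K by (intro add.generate_subgroup_incl) blast+
  then show ?thesis using g unfolding canonical_generates_additively by blast
qed

lemma theta_f_skew_brace_if_theta_f_solution:
  assumes "theta_f_solution X r"
  shows "theta_f_skew_brace B"
proof (rule theta_f_skew_braceI[OF _ canonical_generates_additively])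
  fix s assume "s \<in> \<iota> ` X"
  then obtain x where x: "x \<in> X" "s = \<iota> x" by blast
  then obtain Y where "decomposition_factor X r Y" and fin: "finite Y" and xY: "x \<in> Y"
    using assms unfolding theta_f_solution_def theta_f_element_def by blast
  then have inv: "invariant_subset X r Y" using decomposition_factor_iff_invariant[OF sol] by simp
  have "sb_theta B (a, b) s \<in> \<iota> ` Y" if "a \<in> carrier B" "b \<in> carrier B" for a b
  proof -
    have "sb_lam B b s \<in> \<iota> ` Y"
      using lam_image_invariant[OF inv that(2)] x(2) xY by blast
    then show ?thesis
      using conjugation_image_invariant[OF inv fin that(1)] unfolding sb_theta_def by auto
  qed
  then have "theta_orbit s \<subseteq> \<iota> ` Y" unfolding theta_orbit_def by blast
  then show "finite (theta_orbit s)" using fin by (meson finite_imageI finite_subset)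
qed auto

text \<open>For \<open>\<rho>\<close> the conjugation formula is read backwards: \<open>\<lambda>\<^sub>w(\<rho>\<^sub>u(y))\<close> is a conjugate of \<open>y\<close>, and the
  permutation \<open>\<lambda>\<^sub>w\<close> is already known not to leave or enter the orbit.\<close>

lemma theta_orbit_preimage_invariant:
  assumes z: "z \<in> carrier B"
  shows "invariant_subset X r {y \<in> X. \<iota> y \<in> theta_orbit z}"
proof -
  have lam_iff: "\<iota> (lam r x y) \<in> theta_orbit z \<longleftrightarrow> \<iota> y \<in> theta_orbit z"
    if "x \<in> X" "y \<in> X" for x y
    using that z lam_in_theta_orbit_iff[of z "\<iota> x" "\<iota> y"] by (simp add: lam_canonical)
  have "\<iota> (rho r u y) \<in> theta_orbit z \<longleftrightarrow> \<iota> y \<in> theta_orbit z"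
    if "u \<in> X" "y \<in> X" for u y
  proof -
    let ?w = "lam r y u"
    have w: "?w \<in> X" "rho r u y \<in> X" using that lam_rho_closed by auto
    have "\<iota> (rho r u y) \<in> theta_orbit z \<longleftrightarrow> \<ominus> \<iota> ?w \<oplus> \<iota> y \<oplus> \<iota> ?w \<in> theta_orbit z"
      using w that by (simp add: canonical_conjugate[OF that(2,1) HOL.refl] lam_iff)
    then show ?thesis using conjugate_in_theta_orbit_iff[OF z] w that by simp
  qed
  then show ?thesis
    unfolding invariant_subset_def using lam_iff lam_rho_closed by auto
qed

lemma theta_f_solution_if_theta_f_skew_brace:
  assumes "theta_f_skew_brace B" and inj: "inj_on \<iota> X"
  shows "theta_f_solution X r"
  unfolding theta_f_solution_def theta_f_element_def
proof
  fix x assume x: "x \<in> X"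
  let ?Y = "{y \<in> X. \<iota> y \<in> theta_orbit (\<iota> x)}"
  have "decomposition_factor X r ?Y"
    using x by (simp add: decomposition_factor_iff_invariant[OF sol] theta_orbit_preimage_invariant)
  moreover have "finite (theta_orbit (\<iota> x))" using assms(1) x by (simp add: theta_f_iff)
  then have "finite ?Y"
  proof (rule inj_on_finite[rotated 2])
    show "inj_on \<iota> ?Y" using inj by (rule inj_on_subset) blast
  qed blast
  moreover have "x \<in> ?Y" using x by (simp add: theta_orbit_self)
  ultimately show "\<exists>Y. decomposition_factor X r Y \<and> finite Y \<and> x \<in> Y" by blast
qed

end

theorem corollary6p6:
  fixes X :: "'a set" and r :: "'a \<times> 'a \<Rightarrow> 'a \<times> 'a" and B :: "'a gword set ring"
  assumes "solution X r"
    and "is_structure_skew_brace X r B"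
  shows "(theta_f_solution X r \<longrightarrow> theta_f_skew_brace B) \<and>
         (theta_f_skew_brace B \<and> injective_solution X r \<longrightarrow> theta_f_solution X r)"
proof -
  interpret structure_skew_brace B X r
    using assms by unfold_locales (simp_all add: is_structure_skew_brace_def)
  show ?thesis
    using theta_f_skew_brace_if_theta_f_solution theta_f_solution_if_theta_f_skew_brace
    by (auto simp: injective_solution_def)
qed

end
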